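(* Let $(\mathbb{X},\perp)$ be a $\perp$-restriction category. Then $\mathbb{X}$ is a finitely disjoint $\perp$-restriction category if and only if $\mathbb{X}$ has all binary $\perp$-joins and every binary $\perp$-join is strong.
   Context: Composition is diagrammatic: $fg$ means first $f$, then $g$. A restriction category is a category with an operator sending each $f:A\to B$ to $\overline{f}:A\to A$ such that $\overline{f}f=f$; $\overline{f}\,\overline{g}=\overline{g}\,\overline{f}$ and $\overline{\overline{g}f}=\overline{g}\,\overline{f}$ for $f:A\to B$, $g:A\to C$; and $f\overline{g}=\overline{fg}f$ for $f:A\to B$, $g:B\to C$. For parallel $f,g$: $f\le g$ iff $\overline{f}g=f$ (a partial order). Restriction zeroes: maps $0:A\to B$ with $f0=0=0f$ and $\overline{0}=0$. An interference relation $\perp$ on a restriction category with restriction zeroes is a family of relations between maps with the same domain such that: $1_A\perp 0$; $f\perp g\Rightarrow g\perp f$; $f\perp f\Rightarrow f=0$; $f'\perp g'$, $f\le f'$, $g\le g'$ imply $f\perp g$; $f\perp g\Rightarrow hfk\perp hgk'$ for all composable $h,k,k'$; $f\perp g\Rightarrow\overline{f}\perp\overline{g}$. A $\perp$-restriction category is a restriction category with restriction zeroes and a chosen interference relation $\perp$. The $\perp$-join $\bigsqcup_{i\in I}f_i$ of a family of parallel maps $f_i:A\to B$ with $f_i\perp f_j$ for $i\ne j$ is their least upper bound for $\le$, if it exists. $\mathbb{X}$ has all binary (resp. finite) $\perp$-joins if every two-element (resp. finite) such family has a $\perp$-join and $h\bigsqcup_if_i=\bigsqcup_ihf_i$ for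 all $h:A'\to A$. A $\perp$-join is strong if for every $h:A\to C$ with $f_i\perp h$ for all $i$, $\bigsqcup_if_i\perp h$. A finitely disjoint $\perp$-restriction category is a $\perp$-restriction category that has all finite $\perp$-joins and in which every finite $\perp$-join is strong. *)

theory Defs
  imports Main
begin

text \<open>
  Composition is diagrammatic: \<open>f \<cdot> g\<close> is first \<open>f\<close>, then \<open>g\<close>.  All operations are total
  functions of the logic; they are only constrained on the intended arguments.
\<close>

record ('o, 'a) perp_restriction_data =
  obj   :: "'o set"
  arr   :: "'a set"
  src   :: "'a \<Rightarrow> 'o"
  tgt   :: "'a \<Rightarrow> 'o"
  ide   :: "'o \<Rightarrow> 'a"  ("\<one>\<index>")
  comp  :: "'a \<Rightarrow> 'a \<Rightarrow> 'a"  (infixl "\<cdot>\<index>" 70)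
  rst   :: "'a \<Rightarrow> 'a"
  zmap  :: "'o \<Rightarrow> 'o \<Rightarrow> 'a"  ("\<zero>\<index>")
  perp  :: "'a \<Rightarrow> 'a \<Rightarrow> bool"  (infix "\<bottom>\<index>" 50)

definition maps :: "('o, 'a, 'm) perp_restriction_data_scheme \<Rightarrow> 'o \<Rightarrow> 'o \<Rightarrow> 'a set" where
  "maps X A B = {f \<in> arr X. src X f = A \<and> tgt X f = B}"

locale category =
  fixes X :: "('o, 'a, 'm) perp_restriction_data_scheme" (structure)
  assumes src_obj: "f \<in> arr X \<Longrightarrow> src X f \<in> obj X"
    and tgt_obj: "f \<in> arr X \<Longrightarrow> tgt X f \<in> obj X"
    and ide_maps: "A \<in> obj X \<Longrightarrow> \<one> A \<in> maps X A A"
    and comp_maps: "\<lbrakk>f \<in> maps X A B; g \<in> maps X B C\<rbrakk> \<Longrightarrow> f \<cdot> g \<in> maps X A C"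
    and ide_comp: "f \<in> maps X A B \<Longrightarrow> \<one> A \<cdot> f = f"
    and comp_ide: "f \<in> maps X A B \<Longrightarrow> f \<cdot> \<one> B = f"
    and comp_assoc: "\<lbrakk>f \<in> maps X A B; g \<in> maps X B C; h \<in> maps X C D\<rbrakk>
      \<Longrightarrow> (f \<cdot> g) \<cdot> h = f \<cdot> (g \<cdot> h)"

locale restriction_category = category +
  assumes rst_maps: "f \<in> maps X A B \<Longrightarrow> rst X f \<in> maps X A A"
    and rst_comp_self: "f \<in> maps X A B \<Longrightarrow> rst X f \<cdot> f = f"
    and rst_comm: "\<lbrakk>f \<in> maps X A B; g \<in> maps X A C\<rbrakk>
      \<Longrightarrow> rst X f \<cdot> rst X g = rst X g \<cdot> rst X f"
    and rst_rst_comp: "\<lbrakk>f \<in> maps X A B; g \<in> maps X A C\<rbrakk>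
      \<Longrightarrow> rst X (rst X g \<cdot> f) = rst X g \<cdot> rst X f"
    and comp_rst: "\<lbrakk>f \<in> maps X A B; g \<in> maps X B C\<rbrakk>
      \<Longrightarrow> f \<cdot> rst X g = rst X (f \<cdot> g) \<cdot> f"

definition restr_le :: "('o, 'a, 'm) perp_restriction_data_scheme \<Rightarrow> 'a \<Rightarrow> 'a \<Rightarrow> bool"
    (infix "\<sqsubseteq>\<index>" 50) where
  "f \<sqsubseteq>\<^bsub>X\<^esub> g \<longleftrightarrow> (\<exists>A B. f \<in> maps X A B \<and> g \<in> maps X A B) \<and> rst X f \<cdot>\<^bsub>X\<^esub> g = f"

locale restriction_category_with_zeroes = restriction_category +
  assumes zmap_maps: "\<lbrakk>A \<in> obj X; B \<in> obj X\<rbrakk> \<Longrightarrow> \<zero> A B \<in> maps X A B"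
    and comp_zmap: "\<lbrakk>f \<in> maps X A B; C \<in> obj X\<rbrakk> \<Longrightarrow> f \<cdot> \<zero> B C = \<zero> A C"
    and zmap_comp: "\<lbrakk>f \<in> maps X A B; C \<in> obj X\<rbrakk> \<Longrightarrow> \<zero> C A \<cdot> f = \<zero> C B"
    and rst_zmap: "\<lbrakk>A \<in> obj X; B \<in> obj X\<rbrakk> \<Longrightarrow> rst X (\<zero> A B) = \<zero> A A"

locale perp_restriction_category = restriction_category_with_zeroes +
  assumes perp_same_src: "f \<bottom> g \<Longrightarrow> f \<in> arr X \<and> g \<in> arr X \<and> src X f = src X g"
    and ide_perp_zmap: "\<lbrakk>A \<in> obj X; B \<in> obj X\<rbrakk> \<Longrightarrow> \<one> A \<bottom> \<zero> A B"
    and perp_sym: "f \<bottom> g \<Longrightarrow> g \<bottom> f"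
    and perp_self: "\<lbrakk>f \<in> maps X A B; f \<bottom> f\<rbrakk> \<Longrightarrow> f = \<zero> A B"
    and perp_down: "\<lbrakk>f' \<bottom> g'; f \<sqsubseteq> f'; g \<sqsubseteq> g'\<rbrakk> \<Longrightarrow> f \<bottom> g"
    and perp_comp: "\<lbrakk>f \<in> maps X A B; g \<in> maps X A C; f \<bottom> g;
        h \<in> maps X A' A; k \<in> maps X B B'; k' \<in> maps X C C'\<rbrakk>
      \<Longrightarrow> h \<cdot> f \<cdot> k \<bottom> h \<cdot> g \<cdot> k'"
    and perp_rst: "f \<bottom> g \<Longrightarrow> rst X f \<bottom> rst X g"

text \<open>
  The homset is an explicit argument because the empty family does not determine it.
\<close>

definition perp_family ::
    "('o, 'a, 'm) perp_restriction_data_scheme \<Rightarrow> 'o \<Rightarrow> 'o \<Rightarrow> 'i set \<Rightarrow> ('i \<Rightarrow> 'a) \<Rightarrow> bool" where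
  "perp_family X A B I f \<longleftrightarrow>
     A \<in> obj X \<and> B \<in> obj X \<and> (\<forall>i\<in>I. f i \<in> maps X A B) \<and>
     (\<forall>i\<in>I. \<forall>j\<in>I. i \<noteq> j \<longrightarrow> f i \<bottom>\<^bsub>X\<^esub> f j)"

definition is_perp_join ::
    "('o, 'a, 'm) perp_restriction_data_scheme \<Rightarrow> 'o \<Rightarrow> 'o \<Rightarrow> 'i set \<Rightarrow> ('i \<Rightarrow> 'a) \<Rightarrow> 'a \<Rightarrow> bool" where
  "is_perp_join X A B I f u \<longleftrightarrow>
     perp_family X A B I f \<and> u \<in> maps X A B \<and> (\<forall>i\<in>I. f i \<sqsubseteq>\<^bsub>X\<^esub> u) \<and>
     (\<forall>v\<in>maps X A B. (\<forall>i\<in>I. f i \<sqsubseteq>\<^bsub>X\<^esub> v) \<longrightarrow> u \<sqsubseteq>\<^bsub>X\<^esub> v)"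

definition is_strong_perp_join ::
    "('o, 'a, 'm) perp_restriction_data_scheme \<Rightarrow> 'o \<Rightarrow> 'o \<Rightarrow> 'i set \<Rightarrow> ('i \<Rightarrow> 'a) \<Rightarrow> 'a \<Rightarrow> bool" where
  "is_strong_perp_join X A B I f u \<longleftrightarrow>
     is_perp_join X A B I f u \<and>
     (\<forall>C\<in>obj X. \<forall>h\<in>maps X A C. (\<forall>i\<in>I. f i \<bottom>\<^bsub>X\<^esub> h) \<longrightarrow> u \<bottom>\<^bsub>X\<^esub> h)"

text \<open>
  In the following, \<open>\<K>\<close> is the collection of admissible index sets.  Every finite family
  can be reindexed by a finite set of natural numbers.
\<close>

definition has_perp_joins ::
    "('o, 'a, 'm) perp_restriction_data_scheme \<Rightarrow> nat set set \<Rightarrow> bool" where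
  "has_perp_joins X \<K> \<longleftrightarrow>
     (\<forall>A B. \<forall>I\<in>\<K>. \<forall>f. perp_family X A B I f \<longrightarrow>
       (\<exists>u. is_perp_join X A B I f u) \<and>
       (\<forall>u. is_perp_join X A B I f u \<longrightarrow>
         (\<forall>A'. \<forall>h\<in>maps X A' A. is_perp_join X A' B I (\<lambda>i. h \<cdot>\<^bsub>X\<^esub> f i) (h \<cdot>\<^bsub>X\<^esub> u))))"

definition perp_joins_strong ::
    "('o, 'a, 'm) perp_restriction_data_scheme \<Rightarrow> nat set set \<Rightarrow> bool" where
  "perp_joins_strong X \<K> \<longleftrightarrow>
     (\<forall>A B. \<forall>I\<in>\<K>. \<forall>f u. is_perp_join X A B I f u \<longrightarrow> is_strong_perp_join X A B I f u)"

abbreviation "has_binary_perp_joins X \<equiv> has_perp_joins X {I. card I = 2}"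
abbreviation "has_finite_perp_joins X \<equiv> has_perp_joins X {I. finite I}"
abbreviation "binary_perp_joins_strong X \<equiv> perp_joins_strong X {I. card I = 2}"
abbreviation "finite_perp_joins_strong X \<equiv> perp_joins_strong X {I. finite I}"

locale finitely_disjoint_perp_restriction_category = perp_restriction_category +
  assumes finite_joins: "has_finite_perp_joins X"
    and finite_joins_strong: "finite_perp_joins_strong X"

end

theory Submission
  imports Defs
begin

text \<open>
  A finite \<open>\<bottom>\<close>-join is built by adjoining one map at a time, starting from the zero map.
  Strength of the join \<open>u\<close> of the maps treated so far makes \<open>u\<close> disjoint from the next map,
  so that the next binary \<open>\<bottom>\<close>-join exists; hence existence, strength and stability under
  precomposition have to be carried through the induction simultaneously.
\<close>

context category
begin

lemma maps_obj:
  assumes "f \<in> maps X A B"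
  shows "A \<in> obj X" and "B \<in> obj X"
  using assms src_obj tgt_obj by (auto simp: maps_def)

end

context restriction_category
begin

lemma restr_le_iff:
  assumes "f \<in> maps X A B" "g \<in> maps X A B"
  shows "f \<sqsubseteq> g \<longleftrightarrow> rst X f \<cdot> g = f"
  using assms by (auto simp: restr_le_def)

text \<open>Restriction idempotents with the same source commute: \<open>f\<close> equals
  \<open>rst X f \<cdot> rst X g \<cdot> f\<close>, and swapping the two idempotents turns this into
  \<open>rst X g \<cdot> f\<close>, which is \<open>g\<close>.\<close>

lemma restr_le_antisym:
  assumes f: "f \<in> maps X A B" and g: "g \<in> maps X A B" and "f \<sqsubseteq> g" "g \<sqsubseteq> f"
  shows "f = g"
proof -
  have fg: "rst X f \<cdot> g = f" and gf: "rst X g \<cdot> f = g"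
    using assms by (simp_all add: restr_le_def)
  have "f = rst X f \<cdot> (rst X g \<cdot> f)" using fg gf by simp
  also have "\<dots> = rst X f \<cdot> rst X g \<cdot> f" by (rule comp_assoc[OF rst_maps[OF f] rst_maps[OF g] f, symmetric])
  also have "\<dots> = rst X g \<cdot> rst X f \<cdot> f" by (simp add: rst_comm[OF f g])
  also have "\<dots> = rst X g \<cdot> (rst X f \<cdot> f)" by (rule comp_assoc[OF rst_maps[OF g] rst_maps[OF f] f])
  also have "\<dots> = g" using gf by (simp add: rst_comp_self[OF f])
  finally show ?thesis .
qed

lemma restr_le_trans:
  assumes f: "f \<in> maps X A B" and g: "g \<in> maps X A B" and k: "k \<in> maps X A B"
    and "f \<sqsubseteq> g" "g \<sqsubseteq> k"
  shows "f \<sqsubseteq> k"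
proof -
  have fg: "rst X f \<cdot> g = f" and gk: "rst X g \<cdot> k = g"
    using assms by (simp_all add: restr_le_def)
  \<comment> \<open>Taking restrictions on both sides of \<open>rst X f \<cdot> g = f\<close> gives
    \<open>rst X f \<cdot> rst X g = rst X f\<close>, so \<open>rst X g\<close> may be
    inserted.\<close>
  have "rst X f \<cdot> k = rst X f \<cdot> rst X g \<cdot> k"
    using rst_rst_comp[OF g f] by (simp add: fg)
  also have "\<dots> = rst X f \<cdot> (rst X g \<cdot> k)" by (rule comp_assoc[OF rst_maps[OF f] rst_maps[OF g] k])
  also have "\<dots> = f" by (simp add: fg gk)
  finally show ?thesis using f k by (simp add: restr_le_iff)
qed

lemma is_perp_join_unique:
  assumes "is_perp_join X A B I f u" "is_perp_join X A B I f v"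
  shows "u = v"
  using assms by (auto simp: is_perp_join_def intro!: restr_le_antisym[of u A B v])

text \<open>The pair \<open>u\<close>, \<open>f x\<close> has the same upper bounds as the whole
  family, because \<open>u\<close> is least above the maps indexed by \<open>I\<close>. The pair is
  an arbitrary \<open>g\<close> at indices \<open>i\<close>, \<open>j\<close>, so that the lemma
  also applies to precomposed pairs.\<close>

lemma is_perp_join_insert:
  assumes fam: "perp_family X A B (insert x I) f"
    and u: "is_perp_join X A B I f u"
    and w: "is_perp_join X A B {i, j} g w"
    and g: "g i = u" "g j = f x"
  shows "is_perp_join X A B (insert x I) f w"
proof -
  have um: "u \<in> maps X A B" and wm: "w \<in> maps X A B" and uw: "u \<sqsubseteq> w" and xw: "f x \<sqsubseteq> w"
    using u w g by (auto simp: is_perp_join_def)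
  have "f k \<sqsubseteq> w" if "k \<in> I" for k
  proof (rule restr_le_trans[OF _ um wm _ uw])
    show "f k \<in> maps X A B" using fam that by (simp add: perp_family_def)
    show "f k \<sqsubseteq> u" using u that by (simp add: is_perp_join_def)
  qed
  moreover have "w \<sqsubseteq> v" if "v \<in> maps X A B" "\<forall>k\<in>insert x I. f k \<sqsubseteq> v" for v
  proof -
    have "u \<sqsubseteq> v" using u that by (simp add: is_perp_join_def)
    then show ?thesis using w g that by (simp add: is_perp_join_def)
  qed
  ultimately show ?thesis using fam wm xw by (simp add: is_perp_join_def)
qed

end

context perp_restriction_category
begin

lemma perp_precomp:
  assumes f: "f \<in> maps X A B" and g: "g \<in> maps X A C" and "f \<bottom> g" and h: "h \<in> maps X A' A"
  shows "h \<cdot> f \<bottom> h \<cdot> g"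
  using perp_comp[OF f g \<open>f \<bottom> g\<close> h ide_maps[OF maps_obj(2)[OF f]] ide_maps[OF maps_obj(2)[OF g]]]
  by (simp add: comp_ide[OF comp_maps[OF h f]] comp_ide[OF comp_maps[OF h g]])

lemma perp_family_precomp:
  assumes "perp_family X A B I f" and h: "h \<in> maps X A' A"
  shows "perp_family X A' B I (\<lambda>i. h \<cdot> f i)"
  using assms maps_obj[OF h]
  by (auto simp: perp_family_def intro: comp_maps[OF h] perp_precomp[OF _ _ _ h])

text \<open>Postcompose the identity in \<open>\<one> A \<bottom> \<zero> A B\<close> with
  \<open>h\<close>. This makes the empty join strong.\<close>

lemma zmap_perp:
  assumes h: "h \<in> maps X A C" and B: "B \<in> obj X"
  shows "\<zero> A B \<bottom> h"
proof -
  note A = maps_obj(1)[OF h]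
  note i = ide_maps[OF A] and z = zmap_maps[OF A B]
  have "\<one> A \<cdot> \<one> A \<cdot> h \<bottom> \<one> A \<cdot> \<zero> A B \<cdot> \<one> B"
    by (rule perp_comp[OF i z ide_perp_zmap[OF A B] i h ide_maps[OF B]])
  then have "h \<bottom> \<zero> A B"
    by (simp add: ide_comp[OF i] ide_comp[OF h] ide_comp[OF z] comp_ide[OF z])
  then show ?thesis by (rule perp_sym)
qed

lemma zmap_restr_le:
  assumes v: "v \<in> maps X A B"
  shows "\<zero> A B \<sqsubseteq> v"
  using maps_obj[OF v] v
  by (simp add: restr_le_iff[OF zmap_maps v] rst_zmap zmap_comp[OF v])

text \<open>Every map of the homset bounds the empty family, so its join is the least map of the
  homset, which is zero.\<close>

lemma is_perp_join_empty:
  assumes "A \<in> obj X" "B \<in> obj X"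
  shows "is_perp_join X A B {} f (\<zero> A B)"
  using assms by (simp add: is_perp_join_def perp_family_def zmap_maps zmap_restr_le)

text \<open>One well-behaved join is enough: joins are unique, so its strength and stability pass to
  every join of the family.\<close>

lemma finite_perp_join_exists:
  fixes f :: "'i \<Rightarrow> 'b"
  assumes bin: "has_binary_perp_joins X" and strong: "binary_perp_joins_strong X"
    and "finite I" and "perp_family X A B I f"
  shows "\<exists>u. is_strong_perp_join X A B I f u \<and>
    (\<forall>A'. \<forall>h\<in>maps X A' A. is_perp_join X A' B I (\<lambda>i. h \<cdot> f i) (h \<cdot> u))"
  using assms(3,4)
proof (induction I)
  case empty
  then have A: "A \<in> obj X" and B: "B \<in> obj X" by (simp_all add: perp_family_def)
  have "is_strong_perp_join X A B {} f (\<zero> A B)"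
    using A B by (simp add: is_strong_perp_join_def is_perp_join_empty zmap_perp)
  moreover have "is_perp_join X A' B {} (\<lambda>i. h \<cdot> f i) (h \<cdot> \<zero> A B)" if h: "h \<in> maps X A' A" for A' h
    using is_perp_join_empty[OF maps_obj(1)[OF h] B] by (simp add: comp_zmap[OF h B])
  ultimately show ?case by blast
next
  case (insert x I)
  then have "perp_family X A B I f" by (simp add: perp_family_def)
  with insert.IH obtain u where u: "is_strong_perp_join X A B I f u"
    and u_pre: "\<And>A' h. h \<in> maps X A' A \<Longrightarrow> is_perp_join X A' B I (\<lambda>i. h \<cdot> f i) (h \<cdot> u)"
    by blast
  have A: "A \<in> obj X" and B: "B \<in> obj X" and x: "f x \<in> maps X A B"
    and xI: "\<forall>i\<in>I. f i \<bottom> f x"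
    using insert.prems insert.hyps by (auto simp: perp_family_def)
  have um: "u \<in> maps X A B" and uj: "is_perp_join X A B I f u"
    using u by (simp_all add: is_strong_perp_join_def is_perp_join_def)
  \<comment> \<open>Strength of \<open>u\<close>, tested against the next map
    \<open>f x\<close>.\<close>
  have ux: "u \<bottom> f x" using u xI x B by (simp add: is_strong_perp_join_def)
  \<comment> \<open>The binary hypotheses concern families indexed by sets of naturals, whereas
    \<open>I\<close> lies in an arbitrary type; hence the pair is indexed by 0 and 1.\<close>
  define g where "g i = (if i = (0::nat) then u else f x)" for i
  have g: "g 0 = u" "g 1 = f x" by (simp_all add: g_def)
  have "perp_family X A B {0, 1} g"
    using A B um x ux perp_sym[OF ux] by (simp add: perp_family_def g_def)
  moreover have "{0, 1::nat} \<in> {I. card I = 2}" by simp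
  ultimately obtain w where w: "is_perp_join X A B {0, 1} g w"
    and w_pre: "\<And>A' h. h \<in> maps X A' A \<Longrightarrow> is_perp_join X A' B {0, 1} (\<lambda>i. h \<cdot> g i) (h \<cdot> w)"
    using bin unfolding has_perp_joins_def by blast
  have ws: "is_strong_perp_join X A B {0, 1} g w"
    using strong w \<open>{0, 1} \<in> _\<close> unfolding perp_joins_strong_def by blast
  have "is_perp_join X A B (insert x I) f w"
    by (rule is_perp_join_insert[OF insert.prems uj w g])
  moreover have "w \<bottom> h" if "h \<in> maps X A C" "C \<in> obj X" "\<forall>i\<in>insert x I. f i \<bottom> h" for h C
  proof -
    \<comment> \<open>Strength is used twice: that of \<open>u\<close> reduces the family to the
      pair \<open>u\<close>, \<open>f x\<close>, and that of the binary join then reaches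
      \<open>w\<close>.\<close>
    have "u \<bottom> h" using u that by (simp add: is_strong_perp_join_def)
    then show ?thesis using ws g that by (simp add: is_strong_perp_join_def)
  qed
  moreover have "is_perp_join X A' B (insert x I) (\<lambda>i. h \<cdot> f i) (h \<cdot> w)"
    if h: "h \<in> maps X A' A" for A' h
    \<comment> \<open>The insertion argument is repeated for the precomposed maps, with
      \<open>h \<cdot> u\<close> as the join over \<open>I\<close> and \<open>h \<cdot> w\<close> as
      the join of the pair.\<close>
    by (rule is_perp_join_insert[OF perp_family_precomp[OF insert.prems h] u_pre[OF h] w_pre[OF h]])
      (simp_all add: g_def)
  ultimately show ?case unfolding is_strong_perp_join_def by blast
qed

end

theorem lemma4p5:
  fixes X :: "('o, 'a, 'm) perp_restriction_data_scheme"
  assumes "perp_restriction_category X"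
  shows "finitely_disjoint_perp_restriction_category X \<longleftrightarrow>
    has_binary_perp_joins X \<and> binary_perp_joins_strong X"
proof
  assume "finitely_disjoint_perp_restriction_category X"
  then have "has_finite_perp_joins X" "finite_perp_joins_strong X"
    by (simp_all add: finitely_disjoint_perp_restriction_category.finite_joins
        finitely_disjoint_perp_restriction_category.finite_joins_strong)
  \<comment> \<open>Two-element index sets are among the finite ones, so both properties
    specialise.\<close>
  moreover have "finite I" if "card I = 2" for I :: "nat set"
    using that by (simp add: card_ge_0_finite)
  ultimately show "has_binary_perp_joins X \<and> binary_perp_joins_strong X"
    unfolding has_perp_joins_def perp_joins_strong_def by blast
next
  interpret perp_restriction_category X by fact
  assume bin: "has_binary_perp_joins X \<and> binary_perp_joins_strong X"
  note ex = finite_perp_join_exists[OF conjunct1[OF bin] conjunct2[OF bin]]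
  show "finitely_disjoint_perp_restriction_category X"
  proof
    show "has_finite_perp_joins X"
      unfolding has_perp_joins_def
    proof (intro allI ballI impI)
      fix A B and I :: "nat set" and f
      assume "I \<in> {I. finite I}" and fam: "perp_family X A B I f"
      then obtain u where u: "is_perp_join X A B I f u"
        and u_pre: "\<And>A' h. h \<in> maps X A' A \<Longrightarrow> is_perp_join X A' B I (\<lambda>i. h \<cdot>\<^bsub>X\<^esub> f i) (h \<cdot>\<^bsub>X\<^esub> u)"
        using ex[of I A B f] unfolding is_strong_perp_join_def by blast
      then show "(\<exists>u. is_perp_join X A B I f u) \<and>
        (\<forall>u. is_perp_join X A B I f u \<longrightarrow>
          (\<forall>A'. \<forall>h\<in>maps X A' A. is_perp_join X A' B I (\<lambda>i. h \<cdot>\<^bsub>X\<^esub> f i) (h \<cdot>\<^bsub>X\<^esub> u)))"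
        \<comment> \<open>Stability is demanded of every join of the family, and each of them is
          \<open>u\<close>.\<close>
        using is_perp_join_unique[OF u] by blast
    qed
    show "finite_perp_joins_strong X"
      unfolding perp_joins_strong_def
    proof (intro allI ballI impI)
      fix A B and I :: "nat set" and f v
      assume "I \<in> {I. finite I}" and v: "is_perp_join X A B I f v"
      then obtain u where u: "is_strong_perp_join X A B I f u"
        using ex[of I A B f] by (auto simp: is_perp_join_def)
      then have "u = v"
        using v is_perp_join_unique by (auto simp: is_strong_perp_join_def)
      with u show "is_strong_perp_join X A B I f v" by simp
    qed
  qed
qed

end
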